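(* Let $r,t\in\mathbb{N}$. There are constants $\alpha=\alpha(r,t)>0$ and $q_0=q_0(r,t)$ such that the following holds for every odd prime power $q>q_0$. There exists a partition $SL_2(\mathbb{F}_q)=\bigcup_{i=1}^r E_i$ such that for every finite coloring of $SL_2(\mathbb{F}_q)$ with $t$ colors, $SL_2(\mathbb{F}_q)=\bigcup_{j=1}^t F_j$, there exist a single color class $F_m$, $1\le m\le t$, and an element $h\in SL_2(\mathbb{F}_q)$ such that \[ \forall\, i\in\{1,\ldots,r\},\quad |(F_m\cdot h)\cap E_i|\ge \alpha\,|SL_2(\mathbb{F}_q)|. \]
   Context: $\mathbb{N}$ is the set of positive integers. $\mathbb{F}_q$ is the finite field with $q$ elements and $SL_2(\mathbb{F}_q)$ is the group of $2\times2$ matrices over $\mathbb{F}_q$ with determinant $1$. A coloring with $t$ colors is a partition into $t$ pairwise disjoint sets $F_1,\dots,F_t$ (the color classes). $F\cdot h=\{gh: g\in F\}$ (right multiplication by $h$). *)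

theory Defs
  imports "HOL-Algebra.Algebra" "HOL-Number_Theory.Prime_Powers" "HOL-Library.Disjoint_Sets"
begin

text \<open>The tuple \<open>((a, b), (c, d))\<close> is the matrix with rows \<open>(a, b)\<close> and \<open>(c, d)\<close>.\<close>

type_synonym 'a mat2 = "('a \<times> 'a) \<times> ('a \<times> 'a)"

definition SL2 :: "('a, 'm) ring_scheme \<Rightarrow> 'a mat2 monoid" where
  "SL2 R = \<lparr>
     carrier = {((a, b), (c, d)) | a b c d.
        a \<in> carrier R \<and> b \<in> carrier R \<and> c \<in> carrier R \<and> d \<in> carrier R \<and>
        a \<otimes>\<^bsub>R\<^esub> d \<ominus>\<^bsub>R\<^esub> b \<otimes>\<^bsub>R\<^esub> c = \<one>\<^bsub>R\<^esub>},
     monoid.mult = (\<lambda>((a, b), (c, d)) ((a', b'), (c', d')).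
        ((a \<otimes>\<^bsub>R\<^esub> a' \<oplus>\<^bsub>R\<^esub> b \<otimes>\<^bsub>R\<^esub> c', a \<otimes>\<^bsub>R\<^esub> b' \<oplus>\<^bsub>R\<^esub> b \<otimes>\<^bsub>R\<^esub> d'),
         (c \<otimes>\<^bsub>R\<^esub> a' \<oplus>\<^bsub>R\<^esub> d \<otimes>\<^bsub>R\<^esub> c', c \<otimes>\<^bsub>R\<^esub> b' \<oplus>\<^bsub>R\<^esub> d \<otimes>\<^bsub>R\<^esub> d'))),
     one = ((\<one>\<^bsub>R\<^esub>, \<zero>\<^bsub>R\<^esub>), (\<zero>\<^bsub>R\<^esub>, \<one>\<^bsub>R\<^esub>))\<rparr>"

lemma (in cring) group_SL2: "group (SL2 R)"
proof (rule groupI)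
  fix x y assume "x \<in> carrier (SL2 R)" "y \<in> carrier (SL2 R)"
  then show "x \<otimes>\<^bsub>SL2 R\<^esub> y \<in> carrier (SL2 R)"
  proof (clarsimp simp: SL2_def)
    fix a b c d a' b' c' d'
    assume c: "a \<in> carrier R" "b \<in> carrier R" "c \<in> carrier R" "d \<in> carrier R"
      "a' \<in> carrier R" "b' \<in> carrier R" "c' \<in> carrier R" "d' \<in> carrier R"
      and e: "a \<otimes> d \<ominus> b \<otimes> c = \<one>" "a' \<otimes> d' \<ominus> b' \<otimes> c' = \<one>"
    have "(a \<otimes> a' \<oplus> b \<otimes> c') \<otimes> (c \<otimes> b' \<oplus> d \<otimes> d') \<ominus> (a \<otimes> b' \<oplus> b \<otimes> d') \<otimes> (c \<otimes> a' \<oplus> d \<otimes> c')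
      = (a \<otimes> d \<ominus> b \<otimes> c) \<otimes> (a' \<otimes> d' \<ominus> b' \<otimes> c')"
      using c by algebra
    then show "(a \<otimes> a' \<oplus> b \<otimes> c') \<otimes> (c \<otimes> b' \<oplus> d \<otimes> d') \<ominus> (a \<otimes> b' \<oplus> b \<otimes> d') \<otimes> (c \<otimes> a' \<oplus> d \<otimes> c') = \<one>"
      using e by simp
  qed
next
  show "\<one>\<^bsub>SL2 R\<^esub> \<in> carrier (SL2 R)"
    by (simp add: SL2_def minus_eq)
next
  fix x y z assume "x \<in> carrier (SL2 R)" "y \<in> carrier (SL2 R)" "z \<in> carrier (SL2 R)"
  then show "x \<otimes>\<^bsub>SL2 R\<^esub> y \<otimes>\<^bsub>SL2 R\<^esub> z = x \<otimes>\<^bsub>SL2 R\<^esub> (y \<otimes>\<^bsub>SL2 R\<^esub> z)"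
    by (clarsimp simp: SL2_def l_distr r_distr m_assoc a_ac)
next
  fix x assume "x \<in> carrier (SL2 R)"
  then show "\<one>\<^bsub>SL2 R\<^esub> \<otimes>\<^bsub>SL2 R\<^esub> x = x"
    by (auto simp: SL2_def)
next
  fix x assume "x \<in> carrier (SL2 R)"
  then obtain a b c d where x: "x = ((a, b), (c, d))"
    and c: "a \<in> carrier R" "b \<in> carrier R" "c \<in> carrier R" "d \<in> carrier R"
    and e: "a \<otimes> d \<ominus> b \<otimes> c = \<one>"
    by (auto simp: SL2_def)
  have "d \<otimes> a \<ominus> b \<otimes> c = \<one>" "d \<otimes> a \<oplus> \<ominus> b \<otimes> c = \<one>" "\<ominus> c \<otimes> b \<oplus> a \<otimes> d = \<one>"
    "d \<otimes> b \<oplus> \<ominus> b \<otimes> d = \<zero>" "\<ominus> c \<otimes> a \<oplus> a \<otimes> c = \<zero>" "d \<otimes> a \<ominus> \<ominus> b \<otimes> \<ominus> c = \<one>"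
    using c e by algebra+
  with c show "\<exists>y\<in>carrier (SL2 R). y \<otimes>\<^bsub>SL2 R\<^esub> x = \<one>\<^bsub>SL2 R\<^esub>"
    by (intro bexI[of _ "((d, \<ominus> b), (\<ominus> c, a))"]) (auto simp: SL2_def x)
qed

text \<open>Parts may be empty: a coloring with \<open>k\<close> colors need not use all of them.\<close>

definition is_partition :: "'b set \<Rightarrow> nat \<Rightarrow> (nat \<Rightarrow> 'b set) \<Rightarrow> bool" where
  "is_partition S k P \<longleftrightarrow> (\<Union>i\<in>{1..k}. P i) = S \<and> disjoint_family_on P {1..k}"

text \<open>
  Fields are rings with carrier in \<^typ>\<open>nat\<close>, so that the constants can be chosen before the
  field and uniformly in it (a type-class field could only be fixed outside the whole statement).
  This covers all finite fields up to isomorphism: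
\<close>

lemma finite_field_nat_copy:
  fixes K :: "'a ring"
  assumes "field K" "finite (carrier K)"
  shows "\<exists>L :: nat ring. field L \<and> K \<simeq> L"
proof -
  interpret field K by fact
  obtain f :: "'a \<Rightarrow> nat" where f: "inj_on f (carrier K)"
    using finite_imp_inj_to_nat_seg[OF assms(2)] by blast
  have "field (image_ring f K)"
    using inj_imp_image_ring_is_field[OF f] .
  moreover have "f \<in> ring_iso K (image_ring f K)"
    using inj_imp_image_ring_iso[OF f] .
  ultimately show ?thesis
    unfolding is_ring_iso_def by blast
qed

end

theory Submission
  imports Defs "HOL-Analysis.Convex"
begin

text \<open>
  The argument works in every finite group \<open>G\<close> of large order \<open>n\<close>, with the \<open>E\<^sub>i\<close> being the fibres
  of a random map \<open>c\<close> from \<open>G\<close> to \<open>{1..r}\<close>. Let \<open>w\<^sub>i\<close> be the indicator function of \<open>i\<close> minus \<open>1/r\<close>.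
  The sum of \<open>w\<^sub>i(c(x y)) w\<^sub>i(c(x' y)) w\<^sub>i(c(x y')) w\<^sub>i(c(x' y'))\<close> over all \<open>x, x', y, y'\<close>
  has expectation at most \<open>3n\<^sup>3\<close>: a quadruple contributes only if \<open>x = x'\<close>, \<open>y = y'\<close> or
  \<open>x y = x' y'\<close>, since otherwise \<open>x y\<close> differs from the other three products. Fix \<open>c\<close> for which
  these sums are \<open>O(n\<^sup>3)\<close>. By the Cauchy--Schwarz inequality, for every set \<open>F\<close> and every fixed
  \<open>\<epsilon> > 0\<close>, \<open>\<bar>F h \<inter> E\<^sub>i\<bar>\<close> differs from \<open>\<bar>F\<bar>/r\<close> by less than \<open>\<epsilon>n\<close> for all but \<open>O(n\<^sup>1\<^sup>/\<^sup>2)\<close> elements \<open>h\<close>.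
  So the largest colour class and almost every \<open>h\<close> satisfy the claim.
\<close>

section \<open>Centred indicators and averages over all maps\<close>

definition centred :: "nat \<Rightarrow> nat \<Rightarrow> nat \<Rightarrow> real" where
  "centred r i v = of_bool (v = i) - 1 / real r"

lemma abs_centred_le_1: "1 \<le> r \<Longrightarrow> \<bar>centred r i v\<bar> \<le> 1"
  by (auto simp: centred_def of_bool_def field_simps)

lemma sum_centred_eq_0: "i \<in> {1..r} \<Longrightarrow> (\<Sum>v\<in>{1..r}. centred r i v) = 0"
  by (auto simp: centred_def sum_subtractf of_bool_def)

text \<open>Independence of coordinates: splitting \<open>c\<close> into its value at
  \<open>z\<close> and its restriction to \<open>A - {z}\<close> factors the sum, because
  \<open>\<phi>\<close> ignores the value at \<open>z\<close>; the factor from \<open>z\<close> is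
  the vanishing sum of \<open>u\<close>.\<close>

lemma sum_PiE_eq_0:
  fixes u :: "'b \<Rightarrow> real"
  assumes "z \<in> A" and u: "(\<Sum>v\<in>B. u v) = 0" and upd: "\<And>c v. \<phi> (c(z := v)) = \<phi> c"
  shows "(\<Sum>c\<in>A \<rightarrow>\<^sub>E B. u (c z) * \<phi> c) = 0"
proof -
  have "(\<Sum>c\<in>A \<rightarrow>\<^sub>E B. u (c z) * \<phi> c)
      = (\<Sum>c\<in>(\<lambda>(v, c). c(z := v)) ` (B \<times> (A - {z} \<rightarrow>\<^sub>E B)). u (c z) * \<phi> c)"
    using assms(1) PiE_insert_eq[of z "A - {z}" "\<lambda>_. B"] by (simp add: insert_absorb)
  also have "\<dots> = (\<Sum>p\<in>B \<times> (A - {z} \<rightarrow>\<^sub>E B). u (fst p) * \<phi> (snd p))"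
    by (subst sum.reindex[OF inj_combinator]) (simp_all add: case_prod_unfold upd)
  also have "\<dots> = (\<Sum>v\<in>B. u v) * (\<Sum>c\<in>A - {z} \<rightarrow>\<^sub>E B. \<phi> c)"
    by (simp add: sum_product sum.cartesian_product case_prod_unfold)
  finally show ?thesis using u by simp
qed

text \<open>The factor \<open>g x y\<close> is kept apart so that each summand has the shape
  \<open>u (c z) * \<phi> c\<close> of \<open>sum_PiE_eq_0\<close> with
  \<open>z = x \<otimes> y\<close>.\<close>

lemma sum_square_eq_quadruple_sum:
  fixes g :: "'a \<Rightarrow> 'a \<Rightarrow> real"
  shows "(\<Sum>x\<in>A. \<Sum>x'\<in>A. (\<Sum>y\<in>A. g x y * g x' y)\<^sup>2)
    = (\<Sum>x\<in>A. \<Sum>x'\<in>A. \<Sum>y\<in>A. \<Sum>y'\<in>A. g x y * (g x' y * g x y' * g x' y'))"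
  by (simp only: power2_eq_square sum_product mult.assoc)

section \<open>Random colourings and translates in a finite group\<close>

context group
begin

text \<open>The coincidence of \<open>x \<otimes> y\<close> with \<open>x' \<otimes> y'\<close> is
  written as an equation for \<open>y'\<close>, so that summing over \<open>y'\<close> later counts
  exactly one solution.\<close>

lemma sum_centred_quadruple_le:
  assumes r: "1 \<le> r" and i: "i \<in> {1..r}"
    and G: "x \<in> carrier G" "x' \<in> carrier G" "y \<in> carrier G" "y' \<in> carrier G"
  defines "C \<equiv> carrier G \<rightarrow>\<^sub>E {1..r}" and "w \<equiv> centred r i"
  shows "(\<Sum>c\<in>C. w (c (x \<otimes> y)) * (w (c (x' \<otimes> y)) * w (c (x \<otimes> y')) * w (c (x' \<otimes> y'))))
    \<le> real (card C) * (of_bool (x' = x) + of_bool (y' = y) + of_bool (y' = inv x' \<otimes> (x \<otimes> y)))"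
    (is "?L \<le> _")
proof (cases "x' = x \<or> y' = y \<or> y' = inv x' \<otimes> (x \<otimes> y)")
  case True
  have w: "\<bar>w v\<bar> \<le> 1" for v using abs_centred_le_1[OF r] by (simp add: w_def)
  have "?L \<le> (\<Sum>c\<in>C. 1)"
  proof (rule sum_mono)
    fix c
    have "\<bar>w (c (x \<otimes> y)) * (w (c (x' \<otimes> y)) * w (c (x \<otimes> y')) * w (c (x' \<otimes> y')))\<bar> \<le> 1"
      unfolding abs_mult by (intro mult_le_one w mult_nonneg_nonneg abs_ge_zero)
    then show "w (c (x \<otimes> y)) * (w (c (x' \<otimes> y)) * w (c (x \<otimes> y')) * w (c (x' \<otimes> y'))) \<le> 1"
      by linarith
  qed
  also have "\<dots> = real (card C) * 1" by simp
  also have "\<dots> \<le> real (card C) * (of_bool (x' = x) + of_bool (y' = y) + of_bool (y' = inv x' \<otimes> (x \<otimes> y)))"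
    using True by (intro mult_left_mono) (auto simp: of_bool_def)
  finally show ?thesis .
next
  case False
  \<comment> \<open>Hence the last three factors do not involve the value of \<open>c\<close> at
    \<open>x \<otimes> y\<close>.\<close>
  have ne: "x' \<otimes> y \<noteq> x \<otimes> y" "x \<otimes> y' \<noteq> x \<otimes> y" "x' \<otimes> y' \<noteq> x \<otimes> y"
    using False G by (auto simp: inv_solve_left)
  have "?L = 0"
    unfolding C_def using ne G sum_centred_eq_0[OF i]
    by (intro sum_PiE_eq_0) (auto simp: w_def)
  with False show ?thesis by simp
qed

text \<open>First moment method. Averaging the total over all \<open>i\<close> gives one
  \<open>c\<close> that serves every \<open>i\<close>; as the summands are nonnegative, each is at
  most the total, which costs the factor \<open>r\<close>.\<close>

lemma exists_uniform_colouring: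
  assumes fin: "finite (carrier G)" and r: "1 \<le> r"
  shows "\<exists>c\<in>carrier G \<rightarrow>\<^sub>E {1..r}. \<forall>i\<in>{1..r}.
    (\<Sum>x\<in>carrier G. \<Sum>x'\<in>carrier G.
      (\<Sum>y\<in>carrier G. centred r i (c (x \<otimes> y)) * centred r i (c (x' \<otimes> y)))\<^sup>2)
    \<le> 3 * real r * real (order G) ^ 3"
proof -
  define A C n where "A = carrier G" and "C = A \<rightarrow>\<^sub>E {1..r}" and "n = real (order G)"
  define S where "S c i = (\<Sum>x\<in>A. \<Sum>x'\<in>A.
      (\<Sum>y\<in>A. centred r i (c (x \<otimes> y)) * centred r i (c (x' \<otimes> y)))\<^sup>2)" for c i
  have finA: "finite A" using fin by (simp add: A_def)
  have finC: "finite C" unfolding C_def using finA by (intro finite_PiE) auto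
  have "C \<noteq> {}" using r by (auto simp: C_def PiE_eq_empty_iff)
  have cardA: "real (card A) = n" by (simp add: A_def n_def order_def)
  have S_sum: "(\<Sum>c\<in>C. S c i) \<le> real (card C) * (3 * n ^ 3)" if i: "i \<in> {1..r}" for i
  proof -
    define w where "w = centred r i"
    have "(\<Sum>c\<in>C. S c i) = (\<Sum>c\<in>C. \<Sum>x\<in>A. \<Sum>x'\<in>A. \<Sum>y\<in>A. \<Sum>y'\<in>A.
        w (c (x \<otimes> y)) * (w (c (x' \<otimes> y)) * w (c (x \<otimes> y')) * w (c (x' \<otimes> y'))))"
      unfolding S_def w_def by (intro sum.cong refl sum_square_eq_quadruple_sum)
    also have "\<dots> = (\<Sum>x\<in>A. \<Sum>x'\<in>A. \<Sum>y\<in>A. \<Sum>y'\<in>A. \<Sum>c\<in>C.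
        w (c (x \<otimes> y)) * (w (c (x' \<otimes> y)) * w (c (x \<otimes> y')) * w (c (x' \<otimes> y'))))"
      by (simp only: sum.swap[of _ A C])
    also have "\<dots> \<le> (\<Sum>x\<in>A. \<Sum>x'\<in>A. \<Sum>y\<in>A. \<Sum>y'\<in>A.
        real (card C) * (of_bool (x' = x) + of_bool (y' = y) + of_bool (y' = inv x' \<otimes> (x \<otimes> y))))"
      unfolding w_def C_def A_def
      by (intro sum_mono sum_centred_quadruple_le r i)
    also have "\<dots> = real (card C) * ((\<Sum>x\<in>A. \<Sum>x'\<in>A. \<Sum>y\<in>A. \<Sum>y'\<in>A. of_bool (x' = x))
        + (\<Sum>x\<in>A. \<Sum>x'\<in>A. \<Sum>y\<in>A. \<Sum>y'\<in>A. of_bool (y' = y))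
        + (\<Sum>x\<in>A. \<Sum>x'\<in>A. \<Sum>y\<in>A. \<Sum>y'\<in>A. of_bool (y' = inv x' \<otimes> (x \<otimes> y))))"
      by (simp only: sum_distrib_left[symmetric] sum.distrib)
    also have "(\<Sum>x\<in>A. \<Sum>x'\<in>A. \<Sum>y\<in>A. \<Sum>y'\<in>A. of_bool (x' = x)) = n ^ 3"
      using finA
      by (simp add: of_bool_def cardA power3_eq_cube sum_distrib_left[symmetric] del: sum_of_bool_eq)
    also have "(\<Sum>x\<in>A. \<Sum>x'\<in>A. \<Sum>y\<in>A. \<Sum>y'\<in>A. of_bool (y' = y)) = n ^ 3"
      using finA by (simp add: of_bool_def cardA power3_eq_cube del: sum_of_bool_eq)
    also have "(\<Sum>x\<in>A. \<Sum>x'\<in>A. \<Sum>y\<in>A. \<Sum>y'\<in>A. of_bool (y' = inv x' \<otimes> (x \<otimes> y)))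
        = (\<Sum>x\<in>A. \<Sum>x'\<in>A. \<Sum>y\<in>A. 1::real)"
      using finA by (intro sum.cong refl) (auto simp: of_bool_def A_def simp del: sum_of_bool_eq)
    also have "\<dots> = n ^ 3" by (simp add: cardA power3_eq_cube)
    finally show ?thesis by simp
  qed
  have "\<exists>c\<in>C. (\<Sum>i\<in>{1..r}. S c i) \<le> 3 * real r * n ^ 3"
  proof (rule ccontr)
    assume "\<not> ?thesis"
    then have "(\<Sum>c\<in>C. 3 * real r * n ^ 3) < (\<Sum>c\<in>C. \<Sum>i\<in>{1..r}. S c i)"
      using finC \<open>C \<noteq> {}\<close> by (intro sum_strict_mono) (auto simp only: not_le bex_simps)
    also have "\<dots> = (\<Sum>i\<in>{1..r}. \<Sum>c\<in>C. S c i)" by (rule sum.swap)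
    also have "\<dots> \<le> (\<Sum>i\<in>{1..r}. real (card C) * (3 * n ^ 3))"
      by (rule sum_mono) (rule S_sum)
    also have "\<dots> = (\<Sum>c\<in>C. 3 * real r * n ^ 3)" by simp
    finally show False by simp
  qed
  then obtain c where c: "c \<in> C" "(\<Sum>i\<in>{1..r}. S c i) \<le> 3 * real r * n ^ 3" by blast
  have "S c i \<le> 3 * real r * n ^ 3" if i: "i \<in> {1..r}" for i
  proof -
    have "0 \<le> S c j" for j unfolding S_def by (intro sum_nonneg zero_le_power2)
    then have "S c i \<le> (\<Sum>j\<in>{1..r}. S c j)" by (intro member_le_sum i) auto
    with c(2) show ?thesis by linarith
  qed
  with c(1) show ?thesis unfolding S_def C_def A_def n_def by blast
qed

text \<open>Expanding the square and summing over \<open>h\<close> first leaves a sum of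
  correlations over pairs from \<open>F\<close>. Cauchy-Schwarz makes the terms nonnegative, so the
  pairs may range over the whole group. The bound is thus uniform in \<open>F\<close>, which lets
  the partition be fixed before the colouring.\<close>

lemma sum_translate_square_le:
  fixes g :: "'a \<Rightarrow> real"
  assumes fin: "finite (carrier G)" and F: "F \<subseteq> carrier G"
  shows "(\<Sum>h\<in>carrier G. (\<Sum>f\<in>F. g (f \<otimes> h))\<^sup>2)\<^sup>2
    \<le> (real (order G))\<^sup>2 *
      (\<Sum>x\<in>carrier G. \<Sum>x'\<in>carrier G. (\<Sum>y\<in>carrier G. g (x \<otimes> y) * g (x' \<otimes> y))\<^sup>2)"
proof -
  define A where "A = carrier G"
  define k where "k x x' = (\<Sum>y\<in>A. g (x \<otimes> y) * g (x' \<otimes> y))" for x x'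
  have "(\<Sum>h\<in>A. (\<Sum>f\<in>F. g (f \<otimes> h))\<^sup>2)
      = (\<Sum>h\<in>A. \<Sum>f\<in>F. \<Sum>f'\<in>F. g (f \<otimes> h) * g (f' \<otimes> h))"
    by (simp add: power2_eq_square sum_product)
  also have "\<dots> = (\<Sum>f\<in>F. \<Sum>f'\<in>F. k f f')"
    by (simp only: k_def sum.swap[of _ F A])
  also have "\<dots> = (\<Sum>p\<in>F \<times> F. k (fst p) (snd p))"
    by (simp add: sum.cartesian_product case_prod_unfold)
  finally have "(\<Sum>h\<in>A. (\<Sum>f\<in>F. g (f \<otimes> h))\<^sup>2)\<^sup>2 = (\<Sum>p\<in>F \<times> F. k (fst p) (snd p))\<^sup>2"
    by simp
  also have "\<dots> \<le> (\<Sum>p\<in>F \<times> F. (k (fst p) (snd p))\<^sup>2) * card (F \<times> F)"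
    by (rule sum_squared_le_sum_of_squares)
  also have "\<dots> \<le> (\<Sum>p\<in>A \<times> A. (k (fst p) (snd p))\<^sup>2) * card (A \<times> A)"
    using F fin by (intro mult_mono sum_mono2 of_nat_mono card_mono sum_nonneg) (auto simp: A_def)
  also have "\<dots> = (real (order G))\<^sup>2 * (\<Sum>x\<in>A. \<Sum>x'\<in>A. (k x x')\<^sup>2)"
    by (simp add: sum.cartesian_product case_prod_unfold card_cartesian_product
        power2_eq_square order_def A_def)
  finally show ?thesis by (simp add: A_def k_def)
qed

lemma card_r_coset_Int:
  assumes "F \<subseteq> carrier G" "h \<in> carrier G"
  shows "card ((F #> h) \<inter> {x \<in> carrier G. P x}) = card {f \<in> F. P (f \<otimes> h)}"
proof -
  have "(F #> h) \<inter> {x \<in> carrier G. P x} = (\<lambda>f. f \<otimes> h) ` {f \<in> F. P (f \<otimes> h)}"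
    using assms by (auto simp: r_coset_def)
  moreover have "inj_on (\<lambda>f. f \<otimes> h) {f \<in> F. P (f \<otimes> h)}"
    using assms by (intro inj_onI) (auto simp: subset_iff)
  ultimately show ?thesis by (simp add: card_image)
qed

theorem exists_partition_meeting_translate:
  assumes fin: "finite (carrier G)" and r: "1 \<le> r" and t: "1 \<le> t"
    and large: "order G > 48 * r ^ 7 * t ^ 4"
  shows "\<exists>E. is_partition (carrier G) r E \<and>
    (\<forall>F. is_partition (carrier G) t F \<longrightarrow>
      (\<exists>m\<in>{1..t}. \<exists>h\<in>carrier G. \<forall>i\<in>{1..r}.
        real (card ((F m #> h) \<inter> E i)) \<ge> 1 / (2 * real r * real t) * real (order G)))"
proof -
  define n where "n = real (order G)"
  \<comment> \<open>Half of n/(rt), the expected size of the intersection for a class with n/t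
    elements.\<close>
  define \<beta> where "\<beta> = n / (2 * real r * real t)"
  obtain c where c: "c \<in> carrier G \<rightarrow>\<^sub>E {1..r}" and unif: "\<And>i. i \<in> {1..r} \<Longrightarrow>
    (\<Sum>x\<in>carrier G. \<Sum>x'\<in>carrier G.
      (\<Sum>y\<in>carrier G. centred r i (c (x \<otimes> y)) * centred r i (c (x' \<otimes> y)))\<^sup>2) \<le> 3 * real r * n ^ 3"
    using exists_uniform_colouring[OF fin r] unfolding n_def by blast
  define E where "E i = {x \<in> carrier G. c x = i}" for i
  have n_pos: "n > 0" using large by (simp add: n_def)
  have \<beta>_pos: "\<beta> > 0" using n_pos r t by (simp add: \<beta>_def)
  have "is_partition (carrier G) r E"
    using c by (auto simp: is_partition_def E_def disjoint_family_on_def)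
  moreover have "\<exists>m\<in>{1..t}. \<exists>h\<in>carrier G. \<forall>i\<in>{1..r}. real (card ((F m #> h) \<inter> E i)) \<ge> \<beta>"
    if part: "is_partition (carrier G) t F" for F
  proof -
    have sub: "F m \<subseteq> carrier G" if "m \<in> {1..t}" for m
      using part that by (auto simp: is_partition_def)
    \<comment> \<open>Pigeonhole: some class has at least the average size.\<close>
    have "\<exists>m\<in>{1..t}. n / real t \<le> real (card (F m))"
    proof (rule ccontr)
      assume "\<not> ?thesis"
      then have "(\<Sum>m\<in>{1..t}. real (card (F m))) < (\<Sum>m\<in>{1..t}. n / real t)"
        using t by (intro sum_strict_mono) (auto simp: not_le)
      also have "\<dots> = n" using t by simp
      finally have "(\<Sum>m\<in>{1..t}. real (card (F m))) < n" .
      moreover have "card (carrier G) \<le> (\<Sum>m\<in>{1..t}. card (F m))"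
        using part card_UN_le[of "{1..t}" F] by (simp add: is_partition_def)
      then have "n \<le> (\<Sum>m\<in>{1..t}. real (card (F m)))"
        unfolding n_def order_def of_nat_sum[symmetric] of_nat_le_iff .
      ultimately show False by linarith
    qed
    then obtain m where m: "m \<in> {1..t}" "n / real t \<le> real (card (F m))" by blast
    have finFm: "finite (F m)" using sub[OF m(1)] fin finite_subset by blast
    define bad where "bad i = {h \<in> carrier G. real (card ((F m #> h) \<inter> E i)) < \<beta>}" for i
    have bad_le: "(real (card (bad i)))\<^sup>2 \<le> 48 * real r ^ 5 * real t ^ 4 * n" if i: "i \<in> {1..r}" for i
    proof -
      \<comment> \<open>\<open>D h\<close> is the deviation of the intersection size from |F m|/r.
        For bad \<open>h\<close> it lies below \<open>\<beta>\<close> - 2\<open>\<beta>\<close> =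
        -\<open>\<beta>\<close>.\<close>
      define D where "D h = (\<Sum>f\<in>F m. centred r i (c (f \<otimes> h)))" for h
      have D: "\<beta>\<^sup>2 \<le> (D h)\<^sup>2" if h: "h \<in> bad i" for h
      proof -
        have hG: "h \<in> carrier G" using h by (simp add: bad_def)
        have "D h = real (card {f \<in> F m. c (f \<otimes> h) = i}) - real (card (F m)) / real r"
          using finFm by (simp add: D_def centred_def sum_subtractf Int_def)
        also have "card {f \<in> F m. c (f \<otimes> h) = i} = card ((F m #> h) \<inter> E i)"
          unfolding E_def by (rule card_r_coset_Int[OF sub[OF m(1)] hG, symmetric])
        also have "\<dots> < \<beta>" using h by (simp add: bad_def)
        finally have "D h < \<beta> - real (card (F m)) / real r" by simp
        also have "\<dots> \<le> \<beta> - n / real t / real r"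
          using m(2) by (intro diff_left_mono divide_right_mono) auto
        also have "\<dots> = - \<beta>" using r t by (simp add: \<beta>_def field_simps)
        finally show ?thesis using \<beta>_pos by (simp add: abs_le_square_iff[symmetric])
      qed
      \<comment> \<open>Chebyshev's inequality: each bad \<open>h\<close> contributes at least the
        square of \<open>\<beta>\<close> to the second moment.\<close>
      have "card (bad i) * \<beta>\<^sup>2 \<le> (\<Sum>h\<in>bad i. (D h)\<^sup>2)"
        using D by (rule sum_bounded_below)
      also have "\<dots> \<le> (\<Sum>h\<in>carrier G. (D h)\<^sup>2)"
        using fin by (intro sum_mono2) (auto simp: bad_def)
      finally have "(card (bad i) * \<beta>\<^sup>2)\<^sup>2 \<le> (\<Sum>h\<in>carrier G. (D h)\<^sup>2)\<^sup>2"
        by (intro power_mono) auto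
      also have "\<dots> \<le> n\<^sup>2 * (3 * real r * n ^ 3)"
        unfolding D_def n_def
        by (rule order_trans[OF sum_translate_square_le[OF fin sub[OF m(1)],
                where g = "\<lambda>x. centred r i (c x)"]])
          (use unif[OF i] in \<open>auto intro!: mult_left_mono simp: n_def\<close>)
      finally have le: "(card (bad i) * \<beta>\<^sup>2)\<^sup>2 \<le> n\<^sup>2 * (3 * real r * n ^ 3)" .
      \<comment> \<open>Substitutes n = 2rt\<open>\<beta>\<close>; the fourth power gives the factor
        16, and 16 * 3 = 48.\<close>
      have "(real (card (bad i)))\<^sup>2 * n ^ 4
          = (16 * real r ^ 4 * real t ^ 4) * (card (bad i) * \<beta>\<^sup>2)\<^sup>2"
        using r t by (simp add: \<beta>_def power_mult_distrib power_divide flip: power_mult)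
      also have "\<dots> \<le> (16 * real r ^ 4 * real t ^ 4) * (n\<^sup>2 * (3 * real r * n ^ 3))"
        using le by (intro mult_left_mono) auto
      also have "\<dots> = 48 * (real r * real r ^ 4) * real t ^ 4 * (n\<^sup>2 * n ^ 3)"
        by (simp add: mult_ac)
      also have "real r * real r ^ 4 = real r ^ 5" by (simp flip: power_Suc)
      also have "n\<^sup>2 * n ^ 3 = n * n ^ 4" by (simp flip: power_Suc power_add)
      finally have "(real (card (bad i)))\<^sup>2 * n ^ 4
          \<le> (48 * real r ^ 5 * real t ^ 4 * n) * n ^ 4"
        by (simp only: mult.assoc)
      then show ?thesis by (rule mult_right_le_imp_le) (use n_pos in simp)
    qed
    \<comment> \<open>Union bound: if the \<open>r\<close> bad sets covered the group, the bound on
      each would give n at most 48 r^7 t^4. This is the source of the threshold in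
      \<open>large\<close>.\<close>
    have "\<exists>h\<in>carrier G. \<forall>i\<in>{1..r}. h \<notin> bad i"
    proof (rule ccontr)
      assume "\<not> ?thesis"
      then have "carrier G \<subseteq> (\<Union>i\<in>{1..r}. bad i)" by blast
      then have "order G \<le> card (\<Union>i\<in>{1..r}. bad i)"
        unfolding order_def using fin by (intro card_mono) (auto simp: bad_def)
      also have "\<dots> \<le> (\<Sum>i\<in>{1..r}. card (bad i))" by (intro card_UN_le) auto
      finally have "n \<le> (\<Sum>i\<in>{1..r}. real (card (bad i)))"
        unfolding n_def of_nat_sum[symmetric] of_nat_le_iff .
      also have "\<dots> \<le> (\<Sum>i\<in>{1..r}. sqrt (48 * real r ^ 5 * real t ^ 4 * n))"
        by (intro sum_mono real_le_rsqrt bad_le)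
      finally have "n \<le> real r * sqrt (48 * real r ^ 5 * real t ^ 4 * n)" by simp
      then have "n\<^sup>2 \<le> (real r * sqrt (48 * real r ^ 5 * real t ^ 4 * n))\<^sup>2"
        using n_pos by (intro power_mono) auto
      also have "\<dots> = (real r)\<^sup>2 * (48 * real r ^ 5 * real t ^ 4 * n)"
        using n_pos by (simp add: power_mult_distrib)
      also have "\<dots> = 48 * ((real r)\<^sup>2 * real r ^ 5) * real t ^ 4 * n" by simp
      also have "(real r)\<^sup>2 * real r ^ 5 = real r ^ 7" by (simp flip: power_add)
      finally have "n \<le> 48 * real r ^ 7 * real t ^ 4"
        unfolding power2_eq_square by (rule mult_right_le_imp_le) (rule n_pos)
      also have "\<dots> = real (48 * r ^ 7 * t ^ 4)" by simp
      also have "\<dots> < n" unfolding n_def using large by (simp only: of_nat_less_iff)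
      finally show False by simp
    qed
    then obtain h where "h \<in> carrier G" "\<forall>i\<in>{1..r}. h \<notin> bad i" by blast
    then show ?thesis
      using m(1) by (intro bexI[of _ m] bexI[of _ h]) (auto simp: bad_def not_less)
  qed
  ultimately show ?thesis
    by (intro exI[of _ E]) (simp add: \<beta>_def n_def)
qed

end

section \<open>Transfer to SL2 over a finite field\<close>

lemma (in cring) finite_SL2:
  assumes "finite (carrier R)"
  shows "finite (carrier (SL2 R))"
proof (rule finite_subset)
  show "carrier (SL2 R) \<subseteq> (carrier R \<times> carrier R) \<times> carrier R \<times> carrier R"
    by (auto simp: SL2_def)
qed (use assms in auto)

text \<open>The upper unitriangular matrices form a copy of the ring inside
  \<open>SL2 R\<close>.\<close>

lemma (in cring) card_le_order_SL2:
  assumes "finite (carrier R)"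
  shows "card (carrier R) \<le> order (SL2 R)"
  unfolding order_def
proof (rule card_inj_on_le)
  show "inj_on (\<lambda>a. ((\<one>, a), (\<zero>, \<one>))) (carrier R)" by (auto intro: inj_onI)
  show "(\<lambda>a. ((\<one>, a), (\<zero>, \<one>))) ` carrier R \<subseteq> carrier (SL2 R)"
    by (auto simp: SL2_def minus_eq)
qed (rule finite_SL2[OF assms])

theorem theorem1p5:
  fixes r t :: nat
  assumes "1 \<le> r" and "1 \<le> t"
  shows "\<exists>(\<alpha>::real) (q0::nat). \<alpha> > 0 \<and>
    (\<forall>(q::nat) (K::nat ring).
       odd q \<and> primepow q \<and> q > q0 \<and> field K \<and> finite (carrier K) \<and> card (carrier K) = q \<longrightarrow>
       (\<exists>E. is_partition (carrier (SL2 K)) r E \<and>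
         (\<forall>F. is_partition (carrier (SL2 K)) t F \<longrightarrow>
           (\<exists>m\<in>{1..t}. \<exists>h\<in>carrier (SL2 K). \<forall>i\<in>{1..r}.
              real (card ((F m #>\<^bsub>SL2 K\<^esub> h) \<inter> E i)) \<ge> \<alpha> * real (order (SL2 K))))))"
proof (intro exI[of _ "1 / (2 * real r * real t)"] exI[of _ "48 * r ^ 7 * t ^ 4"] conjI allI impI)
  show "0 < 1 / (2 * real r * real t)" using assms by simp
next
  fix q :: nat and K :: "nat ring"
  assume K: "odd q \<and> primepow q \<and> q > 48 * r ^ 7 * t ^ 4 \<and> field K \<and> finite (carrier K)
    \<and> card (carrier K) = q"
  interpret K: field K using K by blast
  interpret G: group "SL2 K" by (rule K.group_SL2)
  \<comment> \<open>Since \<open>q\<close> is at most the order of \<open>SL2 K\<close>, the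
    threshold on the group order also serves as \<open>q0\<close>.\<close>
  have "finite (carrier K)" "order (SL2 K) > 48 * r ^ 7 * t ^ 4"
    using K K.card_le_order_SL2 by auto
  then show "\<exists>E. is_partition (carrier (SL2 K)) r E \<and>
         (\<forall>F. is_partition (carrier (SL2 K)) t F \<longrightarrow>
           (\<exists>m\<in>{1..t}. \<exists>h\<in>carrier (SL2 K). \<forall>i\<in>{1..r}.
              real (card ((F m #>\<^bsub>SL2 K\<^esub> h) \<inter> E i))
                \<ge> 1 / (2 * real r * real t) * real (order (SL2 K))))"
    by (intro G.exists_partition_meeting_translate K.finite_SL2 assms)
qed

end
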